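(* For each integer $n\ge 1$, the sets \[ H_{n1}(\mathbb{T})=H_+(\mathbb{T})\cap\left\{B(\zeta)/\zeta^{n-1}\colon B\text{ is a Blaschke product of degree } n\right\} \] and \[ H_{n2}(\mathbb{T})=H_+(\mathbb{T})\cap\left\{\zeta^{n+1}/B(\zeta)\colon B\text{ is a Blaschke product of degree } n\right\} \] contain $SO(2,\mathbb{R})$ as a deformation retract. In particular, both sets are connected. The unions $\bigcup_{n=1}^\infty H_{n1}(\mathbb{T})$ and $\bigcup_{n=1}^\infty H_{n2}(\mathbb{T})$ are connected as well.
   Context: $\mathbb{T}=\{z\in\mathbb{C}\colon |z|=1\}$ and $\mathbb{D}=\{z\in\mathbb{C}\colon |z|<1\}$. The space $C(\mathbb{T})$ of continuous maps $\mathbb{T}\to\mathbb{C}$ carries the topology of the norm $\|f\|=\sup_{\mathbb{T}}|f|$, and all subsets of it carry the subspace topology. $H_+(\mathbb{T})\subset C(\mathbb{T})$ is the group of all sense-preserving homeomorphisms $f\colon\mathbb{T}\to\mathbb{T}$. $SO(2,\mathbb{R})\subset H_+(\mathbb{T})$ denotes the group of rotations $z\mapsto\sigma z$, $\sigma\in\mathbb{T}$. A Blaschke product of degree $n$ is a rational function of the form $B(z)=\sigma\prod_{k=1}^n\frac{z-z_k}{1-\overline{z_k}z}$ with $z_1,\dots,z_n\in\mathbb{D}$ (not necessarily distinct) and $\sigma\in\mathbb{T}$. The expressions $B(\zeta)/\zeta^{n-1}$ and $\zeta^{n+1}/B(\zeta)$ are regarded as functions of $\zeta\in\mathbb{T}$.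 A subset $A\subset X$ is a deformation retract of $X$ if there is a continuous map $F\colon X\times[0,1]\to X$ such that $F(\cdot,1)$ is the identity of $X$ and $F(\cdot,0)$ is a retraction of $X$ onto $A$ (that is, $F(x,0)\in A$ for all $x\in X$, and $F(a,0)=a$ for all $a\in A$). *)

theory Defs
  imports "HOL-Analysis.Analysis" "HOL-Complex_Analysis.Complex_Analysis"
begin

abbreviation unit_circle :: "complex set"
  where "unit_circle \<equiv> sphere 0 1"

text \<open>
  \<open>C(\<T>)\<close> with the supremum metric. Its points are functions on \<^typ>\<open>complex\<close> that take the
  value \<^const>\<open>undefined\<close> off the circle, hence the uses of \<^const>\<open>restrict\<close> below.
\<close>
definition CT :: "(complex \<Rightarrow> complex) topology"
  where "CT = mtopology_of (cfunspace (top_of_set unit_circle) euclidean_metric)"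

text \<open>
  The image of the positively oriented unit circle under a self-homeomorphism of the circle winds
  around the origin once, in the positive or in the negative direction; the homeomorphism is
  sense-preserving if it does so in the positive direction.
\<close>
definition H_plus :: "(complex \<Rightarrow> complex) set"
  where "H_plus = {f \<in> topspace CT.
           homeomorphic_map (top_of_set unit_circle) (top_of_set unit_circle) f \<and>
           winding_number (f \<circ> circlepath 0 1) 0 = 1}"

definition SO2 :: "(complex \<Rightarrow> complex) set"
  where "SO2 = {restrict (\<lambda>z. \<sigma> * z) unit_circle | \<sigma>. \<sigma> \<in> unit_circle}"

text \<open>
  The value \<open>0\<close> that \<open>x / 0 = 0\<close> assigns at the poles is immaterial: the poles lie outside the
  closed unit disk, and only values on the unit circle are used.
\<close>
definition blaschke_products :: "nat \<Rightarrow> (complex \<Rightarrow> complex) set"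
  where "blaschke_products n =
           {\<lambda>z. \<sigma> * (\<Prod>k=1..n. (z - a k) / (1 - cnj (a k) * z)) | \<sigma> a.
              \<sigma> \<in> unit_circle \<and> (\<forall>k\<in>{1..n}. a k \<in> ball 0 1)}"

definition H_n1 :: "nat \<Rightarrow> (complex \<Rightarrow> complex) set"
  where "H_n1 n = H_plus \<inter>
           {restrict (\<lambda>\<zeta>. B \<zeta> / \<zeta> ^ (n - 1)) unit_circle | B. B \<in> blaschke_products n}"

definition H_n2 :: "nat \<Rightarrow> (complex \<Rightarrow> complex) set"
  where "H_n2 n = H_plus \<inter>
           {restrict (\<lambda>\<zeta>. \<zeta> ^ (n + 1) / B \<zeta>) unit_circle | B. B \<in> blaschke_products n}"

definition deformation_retract_of_space :: "'a set \<Rightarrow> 'a topology \<Rightarrow> bool"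
    (infix \<open>deformation'_retract'_of'_space\<close> 50)
  where "A deformation_retract_of_space X \<longleftrightarrow>
           A \<subseteq> topspace X \<and>
           (\<exists>F. continuous_map (prod_topology X (top_of_set {0..1::real})) X F \<and>
                (\<forall>x\<in>topspace X. F (x, 1) = x) \<and>
                (\<forall>x\<in>topspace X. F (x, 0) \<in> A) \<and>
                (\<forall>a\<in>A. F (a, 0) = a))"

end

theory Submission
  imports Defs
begin

text \<open>
  Write \<open>f = twist s n \<sigma> a\<close> for the map given by the zeros \<open>a\<close>; the deformation replaces \<open>a\<close> by \<open>t a\<close>.
  The angular speed of \<open>f\<close> on the circle is the real part of a holomorphic function \<open>g\<close> on the
  closed disk with \<open>g 0 = 1\<close>, and scaling the zeros by \<open>t\<close> turns \<open>g\<close> into \<open>g (t z)\<close>. If \<open>f\<close> is a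
  sense-preserving homeomorphism then \<open>Re g \<ge> 0\<close> on the circle, so \<open>Re g > 0\<close> inside by the maximum
  principle for \<open>exp (- g)\<close>, and the scaled maps are homeomorphisms too. For \<open>t = 0\<close> one gets
  a rotation. Continuity in \<open>f\<close> in the supremum norm follows from compactness of the closed
  polydisk of zeros: if some zeros tended to the circle, the limit map would agree, off finitely many
  points, with one given by fewer than \<open>n\<close> zeros in the disk, contradicting the uniqueness of the
  zeros.
\<close>

section \<open>Twists of the circle and Blaschke products\<close>

text \<open>
  On the circle \<open>(\<zeta> - a) / (1 - cnj a * \<zeta>) = \<zeta> * cnj w / w\<close> with \<open>w = 1 - cnj a * \<zeta>\<close>, and
  \<open>cnj w / w = cis (- 2 * Im (Ln w))\<close>. Hence \<open>B \<zeta> / \<zeta> ^ (n - 1)\<close> and \<open>\<zeta> ^ (n + 1) / B \<zeta>\<close> are the cases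
  \<open>s = 1\<close> and \<open>s = -1\<close> of \<open>twist s\<close>.
\<close>
definition twist_angle :: "nat \<Rightarrow> (nat \<Rightarrow> complex) \<Rightarrow> complex \<Rightarrow> real"
  where "twist_angle n a \<zeta> = (\<Sum>k=1..n. Im (Ln (1 - cnj (a k) * \<zeta>)))"

definition twist :: "real \<Rightarrow> nat \<Rightarrow> complex \<Rightarrow> (nat \<Rightarrow> complex) \<Rightarrow> complex \<Rightarrow> complex"
  where "twist s n \<sigma> a \<zeta> = \<sigma> * \<zeta> * cis (- 2 * s * twist_angle n a \<zeta>)"

text \<open>A lift of the restriction of \<open>twist s n \<sigma> a\<close> to the circle, up to the additive constant \<open>arg \<sigma>\<close>.\<close>
definition twist_phase :: "real \<Rightarrow> nat \<Rightarrow> (nat \<Rightarrow> complex) \<Rightarrow> real \<Rightarrow> real"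
  where "twist_phase s n a \<theta> = \<theta> - 2 * s * twist_angle n a (cis \<theta>)"

text \<open>Differentiating \<open>twist_phase\<close> along the circle gives the real part of this
  function. Keeping the complex function makes the dependence on \<open>z\<close> holomorphic, so
  that the maximum principle applies.\<close>

definition twist_speed :: "real \<Rightarrow> nat \<Rightarrow> (nat \<Rightarrow> complex) \<Rightarrow> complex \<Rightarrow> complex"
  where "twist_speed s n a z =
           1 + 2 * of_real s * (\<Sum>k=1..n. cnj (a k) * z / (1 - cnj (a k) * z))"

definition twist_family :: "real \<Rightarrow> nat \<Rightarrow> (complex \<Rightarrow> complex) set"
  where "twist_family s n = H_plus \<inter>
           {restrict (twist s n \<sigma> a) unit_circle | \<sigma> a.
              \<sigma> \<in> unit_circle \<and> (\<forall>k\<in>{1..n}. a k \<in> ball 0 1)}"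

lemma cis_Im_Ln:
  assumes "w \<noteq> 0"
  shows "cis (- 2 * Im (Ln w)) = cnj w / w"
proof -
  have "cnj w = exp (cnj (Ln w))"
    using assms by (simp flip: exp_cnj)
  then have "cnj w / w = exp (cnj (Ln w) - Ln w)"
    using assms by (simp add: exp_diff)
  also have "cnj (Ln w) - Ln w = \<i> * of_real (- 2 * Im (Ln w))"
    by (simp add: complex_eq_iff)
  finally show ?thesis
    by (simp only: cis_conv_exp)
qed

lemma norm_cnj_mult_less_1:
  fixes a z :: complex
  assumes "norm a < 1" "norm z \<le> 1"
  shows "norm (cnj a * z) < 1"
proof -
  have "norm a * norm z \<le> norm a * 1"
    using assms by (intro mult_left_mono) auto
  with assms show ?thesis by (simp add: norm_mult)
qed

lemma Re_one_minus_pos: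
  assumes "norm (w::complex) \<le> 1" "w \<noteq> 1"
  shows "0 < Re (1 - w)"
proof (rule ccontr)
  assume "\<not> ?thesis"
  then have "Re w \<ge> 1" by simp
  moreover have "(Re w)\<^sup>2 + (Im w)\<^sup>2 \<le> 1"
    using assms(1) by (metis cmod_power2 norm_ge_zero power_le_one)
  ultimately have "Re w = 1" "Im w = 0"
    by (smt (verit) one_le_power power2_less_eq_zero_iff zero_le_power2 power2_le_imp_le power_one abs_le_square_iff real_sqrt_abs)+
  with assms(2) show False by (simp add: complex_eq_iff)
qed

lemma blaschke_factor_on_circle:
  fixes a \<zeta> :: complex
  assumes "\<zeta> \<in> unit_circle"
  shows "\<zeta> * cnj (1 - cnj a * \<zeta>) = \<zeta> - a"
proof -
  have "\<zeta> * cnj \<zeta> = 1"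
    using assms by (simp add: complex_norm_square[symmetric])
  then show ?thesis
    by (simp add: algebra_simps)
qed

lemma cis_sum: "cis (\<Sum>k\<in>A. f k) = (\<Prod>k\<in>A. cis (f k))"
  by (induction A rule: infinite_finite_induct) (auto simp: cis_mult[symmetric])

text \<open>Only nonvanishing denominators are assumed, so the identity also serves zeros on the
  circle, away from the points they remove. The powers of \<zeta> are multiplied out to avoid the
  exponent \<open>n - 1\<close>.\<close>

lemma twist_eq_blaschke:
  assumes \<zeta>: "\<zeta> \<in> unit_circle" and nz: "\<And>k. k \<in> {1..n} \<Longrightarrow> 1 - cnj (a k) * \<zeta> \<noteq> 0"
  shows "\<zeta> ^ n * twist 1 n \<sigma> a \<zeta> = \<zeta> * (\<sigma> * (\<Prod>k=1..n. (\<zeta> - a k) / (1 - cnj (a k) * \<zeta>)))"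
proof -
  have "cis (- 2 * twist_angle n a \<zeta>) = (\<Prod>k=1..n. cis (- 2 * Im (Ln (1 - cnj (a k) * \<zeta>))))"
    by (simp add: twist_angle_def sum_distrib_left cis_sum)
  also have "\<dots> = (\<Prod>k=1..n. cnj (1 - cnj (a k) * \<zeta>) / (1 - cnj (a k) * \<zeta>))"
    using nz by (intro prod.cong refl cis_Im_Ln) auto
  finally have "\<zeta> ^ n * cis (- 2 * twist_angle n a \<zeta>) =
      (\<Prod>k=1..n. \<zeta> * (cnj (1 - cnj (a k) * \<zeta>) / (1 - cnj (a k) * \<zeta>)))"
    by (simp only: prod.distrib prod_constant) simp
  also have "\<dots> = (\<Prod>k=1..n. (\<zeta> - a k) / (1 - cnj (a k) * \<zeta>))"
    using blaschke_factor_on_circle[OF \<zeta>] by (intro prod.cong refl) (simp only: times_divide_eq_right)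
  finally show ?thesis
    by (simp add: twist_def algebra_simps)
qed

lemma norm_twist:
  assumes "\<sigma> \<in> unit_circle" "\<zeta> \<in> unit_circle"
  shows "norm (twist s n \<sigma> a \<zeta>) = 1"
  using assms by (simp add: twist_def norm_mult)

text \<open>The two angles cancel. This carries every statement about \<open>s\<close> over to
  \<open>- s\<close>, at the price of conjugating the rotation.\<close>

lemma twist_minus:
  assumes "\<sigma> \<in> unit_circle" "\<zeta> \<in> unit_circle"
  shows "twist s n \<sigma> a \<zeta> * twist (- s) n (cnj \<sigma>) a \<zeta> = \<zeta>\<^sup>2"
proof -
  have "\<sigma> * cnj \<sigma> = 1"
    using assms by (simp add: complex_norm_square[symmetric])
  then have "twist s n \<sigma> a \<zeta> * twist (- s) n (cnj \<sigma>) a \<zeta> =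
      \<zeta>\<^sup>2 * (cis (- 2 * s * twist_angle n a \<zeta>) * cis (- 2 * (- s) * twist_angle n a \<zeta>))"
    unfolding twist_def power2_eq_square by (simp add: algebra_simps)
  then show ?thesis
    by (simp add: cis_mult)
qed

lemma one_minus_cnj_mult_nonzero:
  fixes a \<zeta> :: complex
  assumes "a \<in> ball 0 1" "\<zeta> \<in> unit_circle"
  shows "1 - cnj a * \<zeta> \<noteq> 0"
  using norm_cnj_mult_less_1[of a \<zeta>] assms by auto

lemma blaschke_on_circle_eq_twist:
  assumes n: "n \<ge> 1" and \<sigma>: "\<sigma> \<in> unit_circle" and a: "\<forall>k\<in>{1..n}. a k \<in> ball 0 1"
    and \<zeta>: "\<zeta> \<in> unit_circle"
  shows "\<sigma> * (\<Prod>k=1..n. (\<zeta> - a k) / (1 - cnj (a k) * \<zeta>)) / \<zeta> ^ (n - 1) = twist 1 n \<sigma> a \<zeta>"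
    and "\<zeta> ^ (n + 1) / (\<sigma> * (\<Prod>k=1..n. (\<zeta> - a k) / (1 - cnj (a k) * \<zeta>))) = twist (-1) n (cnj \<sigma>) a \<zeta>"
proof -
  let ?B = "\<sigma> * (\<Prod>k=1..n. (\<zeta> - a k) / (1 - cnj (a k) * \<zeta>))"
  have nz: "\<zeta> \<noteq> 0" using \<zeta> by auto
  \<comment> \<open>Subtraction on \<open>nat\<close> is truncated, so this needs
    \<open>n \<ge> 1\<close>.\<close>
  have pow: "\<zeta> ^ n = \<zeta> * \<zeta> ^ (n - 1)"
    using n by (simp add: power_eq_if)
  have *: "\<zeta> ^ n * twist 1 n \<sigma> a \<zeta> = \<zeta> * ?B"
    using a \<zeta> one_minus_cnj_mult_nonzero by (intro twist_eq_blaschke) blast+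
  with nz pow have B: "?B = \<zeta> ^ (n - 1) * twist 1 n \<sigma> a \<zeta>"
    by simp
  then show "?B / \<zeta> ^ (n - 1) = twist 1 n \<sigma> a \<zeta>"
    using nz by (simp add: field_simps)
  have t0: "twist 1 n \<sigma> a \<zeta> \<noteq> 0"
    using norm_twist[OF \<sigma> \<zeta>, of 1 n a] by auto
  have "\<zeta> ^ (n + 1) = \<zeta> ^ (n - 1) * \<zeta>\<^sup>2"
    by (simp add: pow power2_eq_square)
  also have "\<dots> = ?B * twist (-1) n (cnj \<sigma>) a \<zeta>"
    unfolding B twist_minus[OF \<sigma> \<zeta>, of 1 n a, symmetric] by simp
  finally show "\<zeta> ^ (n + 1) / ?B = twist (-1) n (cnj \<sigma>) a \<zeta>"
    using nz t0 unfolding B by (simp add: nonzero_divide_eq_eq)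
qed

lemma H_n1_eq_twist_family:
  assumes "n \<ge> 1"
  shows "H_n1 n = twist_family 1 n"
proof -
  let ?B = "\<lambda>\<sigma> a z. \<sigma> * (\<Prod>k=1..n. (z - a k) / (1 - cnj (a k) * z))"
  have "{restrict (\<lambda>\<zeta>. B \<zeta> / \<zeta> ^ (n - 1)) unit_circle | B. B \<in> blaschke_products n} =
        {restrict (twist 1 n \<sigma> a) unit_circle | \<sigma> a.
              \<sigma> \<in> unit_circle \<and> (\<forall>k\<in>{1..n}. a k \<in> ball 0 1)}" (is "?L = ?R")
  proof (intro equalityI subsetI)
    fix f assume "f \<in> ?L"
    then obtain \<sigma> a where \<sigma>: "\<sigma> \<in> unit_circle" and a: "\<forall>k\<in>{1..n}. a k \<in> ball 0 1" and
      f: "f = restrict (\<lambda>\<zeta>. \<sigma> * (\<Prod>k=1..n. (\<zeta> - a k) / (1 - cnj (a k) * \<zeta>)) / \<zeta> ^ (n - 1)) unit_circle"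
      unfolding blaschke_products_def by blast
    then have "f = restrict (twist 1 n \<sigma> a) unit_circle"
      using blaschke_on_circle_eq_twist(1)[OF assms \<sigma> a] by (auto intro!: restrict_ext)
    with \<sigma> a show "f \<in> ?R" by blast
  next
    fix f assume "f \<in> ?R"
    then obtain \<sigma> a where \<sigma>: "\<sigma> \<in> unit_circle" and a: "\<forall>k\<in>{1..n}. a k \<in> ball 0 1" and
      f: "f = restrict (twist 1 n \<sigma> a) unit_circle"
      by blast
    then have "f = restrict (\<lambda>\<zeta>. \<sigma> * (\<Prod>k=1..n. (\<zeta> - a k) / (1 - cnj (a k) * \<zeta>)) / \<zeta> ^ (n - 1)) unit_circle"
      using blaschke_on_circle_eq_twist(1)[OF assms \<sigma> a] by (auto intro!: restrict_ext)
    moreover have "?B \<sigma> a \<in> blaschke_products n"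
      using \<sigma> a unfolding blaschke_products_def by blast
    ultimately show "f \<in> ?L" by (intro CollectI exI[of _ "?B \<sigma> a"] conjI)
  qed
  then show ?thesis by (simp add: H_n1_def twist_family_def)
qed

lemma H_n2_eq_twist_family:
  assumes "n \<ge> 1"
  shows "H_n2 n = twist_family (-1) n"
proof -
  let ?B = "\<lambda>\<sigma> a z. \<sigma> * (\<Prod>k=1..n. (z - a k) / (1 - cnj (a k) * z))"
  have "{restrict (\<lambda>\<zeta>. \<zeta> ^ (n + 1) / B \<zeta>) unit_circle | B. B \<in> blaschke_products n} =
        {restrict (twist (-1) n \<sigma> a) unit_circle | \<sigma> a.
              \<sigma> \<in> unit_circle \<and> (\<forall>k\<in>{1..n}. a k \<in> ball 0 1)}" (is "?L = ?R")
  proof (intro equalityI subsetI)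
    fix f assume "f \<in> ?L"
    then obtain \<sigma> a where \<sigma>: "\<sigma> \<in> unit_circle" and a: "\<forall>k\<in>{1..n}. a k \<in> ball 0 1" and
      f: "f = restrict (\<lambda>\<zeta>. \<zeta> ^ (n + 1) / (\<sigma> * (\<Prod>k=1..n. (\<zeta> - a k) / (1 - cnj (a k) * \<zeta>)))) unit_circle"
      unfolding blaschke_products_def by blast
    then have "f = restrict (twist (-1) n (cnj \<sigma>) a) unit_circle"
      using blaschke_on_circle_eq_twist(2)[OF assms \<sigma> a] by (auto intro!: restrict_ext)
    \<comment> \<open>Conjugation permutes the circle, so replacing \<sigma> by its conjugate does
      not change the family.\<close>
    moreover have "cnj \<sigma> \<in> unit_circle" using \<sigma> by simp
    ultimately show "f \<in> ?R" using a by blast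
  next
    fix f assume "f \<in> ?R"
    then obtain \<sigma> a where \<sigma>: "\<sigma> \<in> unit_circle" and a: "\<forall>k\<in>{1..n}. a k \<in> ball 0 1" and
      f: "f = restrict (twist (-1) n \<sigma> a) unit_circle"
      by blast
    have \<sigma>': "cnj \<sigma> \<in> unit_circle" using \<sigma> by simp
    have "f = restrict (\<lambda>\<zeta>. \<zeta> ^ (n + 1) / (cnj \<sigma> * (\<Prod>k=1..n. (\<zeta> - a k) / (1 - cnj (a k) * \<zeta>)))) unit_circle"
      using blaschke_on_circle_eq_twist(2)[OF assms \<sigma>' a] f by (auto intro!: restrict_ext)
    moreover have "?B (cnj \<sigma>) a \<in> blaschke_products n"
      using \<sigma>' a unfolding blaschke_products_def by blast
    ultimately show "f \<in> ?L" by (intro CollectI exI[of _ "?B (cnj \<sigma>) a"] conjI)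
  qed
  then show ?thesis by (simp add: H_n2_def twist_family_def)
qed

section \<open>Lifts to the line and angular speed\<close>

lemma twist_cis: "twist s n (cis c) a (cis \<theta>) = cis (c + twist_phase s n a \<theta>)"
  by (simp add: twist_def twist_phase_def cis_mult algebra_simps)

lemma cis_eq_iff: "cis x = cis y \<longleftrightarrow> (\<exists>k::int. x = y + 2 * pi * of_int k)"
proof -
  have "cis x = cis y \<longleftrightarrow> exp (\<i> * of_real x) = exp (\<i> * of_real y)"
    by (simp add: cis_conv_exp)
  also have "\<dots> \<longleftrightarrow> (\<exists>k::int. x = y + 2 * pi * of_int k)"
    unfolding exp_eq by (simp add: complex_eq_iff algebra_simps)
  finally show ?thesis .
qed

text \<open>\<open>twist_angle\<close> sees \<theta> only through \<open>cis \<theta>\<close>, so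
  \<open>twist_phase\<close> is the identity plus a periodic function: the lift of a circle map of
  degree one.\<close>

lemma twist_phase_plus_2pi_int:
  "twist_phase s n a (\<theta> + 2 * pi * of_int k) = twist_phase s n a \<theta> + 2 * pi * of_int k"
proof -
  have "cis (\<theta> + 2 * pi * of_int k) = cis \<theta>"
    unfolding cis_eq_iff by blast
  then show ?thesis
    by (simp add: twist_phase_def)
qed

lemma twist_phase_plus_2pi: "twist_phase s n a (\<theta> + 2 * pi) = twist_phase s n a \<theta> + 2 * pi"
  using twist_phase_plus_2pi_int[of s n a \<theta> 1] by simp

text \<open>The values lie in the open right half-plane, hence off the branch cut of
  \<open>Ln\<close>.\<close>

lemma one_minus_cnj_mult_notin_nonpos:
  fixes a z :: complex
  assumes "a \<in> ball 0 1" "norm z \<le> 1"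
  shows "1 - cnj a * z \<notin> \<real>\<^sub>\<le>\<^sub>0" "1 - cnj a * z \<noteq> 0"
proof -
  have "0 < Re (1 - cnj a * z)"
    using assms norm_cnj_mult_less_1[of a z] by (intro Re_one_minus_pos) force+
  then show "1 - cnj a * z \<notin> \<real>\<^sub>\<le>\<^sub>0" "1 - cnj a * z \<noteq> 0"
    by (auto simp: complex_nonpos_Reals_iff complex_eq_iff)
qed

lemma has_real_derivative_Im_Ln_cis:
  assumes "a \<in> ball 0 1"
  shows "((\<lambda>\<theta>. Im (Ln (1 - cnj a * cis \<theta>))) has_real_derivative
           - Re (cnj a * cis \<theta> / (1 - cnj a * cis \<theta>))) (at \<theta>)"
proof -
  have cis': "(cis has_vector_derivative \<i> * cis \<theta>) (at \<theta>)"
    unfolding cis_conv_exp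
    by (auto intro!: derivative_eq_intros has_vector_derivative_real_field)
  have Ln': "((\<lambda>z. Ln (1 - cnj a * z)) has_field_derivative
        - cnj a / (1 - cnj a * cis \<theta>)) (at (cis \<theta>))"
    using one_minus_cnj_mult_notin_nonpos[OF assms, of "cis \<theta>"]
    by (auto intro!: derivative_eq_intros simp: field_simps)
  have "((\<lambda>\<theta>. Im (Ln (1 - cnj a * cis \<theta>))) has_vector_derivative
      Im (\<i> * cis \<theta> * (- cnj a / (1 - cnj a * cis \<theta>)))) (at \<theta>)"
    using bounded_linear.has_vector_derivative[OF bounded_linear_Im field_vector_diff_chain_at[OF cis' Ln']]
    by (simp add: o_def)
  \<comment> \<open>Pulling out the factor \<i>, which comes from differentiating
    \<open>cis\<close>, turns the imaginary part into a real part.\<close>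
  moreover have "\<i> * cis \<theta> * (- cnj a / (1 - cnj a * cis \<theta>)) =
      - (\<i> * (cnj a * cis \<theta> / (1 - cnj a * cis \<theta>)))"
    by (simp add: field_simps)
  then have "Im (\<i> * cis \<theta> * (- cnj a / (1 - cnj a * cis \<theta>))) =
      - Re (cnj a * cis \<theta> / (1 - cnj a * cis \<theta>))"
    by (simp only: uminus_complex.sel Im_i_times)
  ultimately show ?thesis
    by (simp only: has_real_derivative_iff_has_vector_derivative)
qed

lemma has_real_derivative_twist_phase:
  assumes "\<forall>k\<in>{1..n}. a k \<in> ball 0 1"
  shows "(twist_phase s n a has_real_derivative Re (twist_speed s n a (cis \<theta>))) (at \<theta>)"
proof -
  have "((\<lambda>\<theta>. twist_angle n a (cis \<theta>)) has_real_derivative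
      (\<Sum>k=1..n. - Re (cnj (a k) * cis \<theta> / (1 - cnj (a k) * cis \<theta>)))) (at \<theta>)"
    unfolding twist_angle_def
    using assms by (intro DERIV_sum has_real_derivative_Im_Ln_cis) auto
  from DERIV_diff[OF DERIV_ident DERIV_cmult[OF this, of "2 * s"]]
  show ?thesis
    unfolding twist_phase_def[abs_def] twist_speed_def
    by (simp add: sum_negf mult.assoc del: times_divide_eq_right)
qed

lemma continuous_on_twist_phase:
  assumes "\<forall>k\<in>{1..n}. a k \<in> ball 0 1"
  shows "continuous_on A (twist_phase s n a)"
  using has_real_derivative_twist_phase[OF assms]
  by (meson DERIV_isCont continuous_at_imp_continuous_on)

text \<open>A real factor passes through \<open>cnj\<close>, so it can be moved from the zeros to
  the argument. Shrinking the zeros thus means evaluating the original speed inside the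
  disk.\<close>

lemma twist_speed_scale:
  "twist_speed s n (\<lambda>k. of_real t * a k) z = twist_speed s n a (of_real t * z)"
  by (simp add: twist_speed_def ac_simps)

section \<open>Sign of the speed and homeomorphisms of the circle\<close>

lemma Re_twist_speed_pos:
  assumes a: "\<forall>k\<in>{1..n}. a k \<in> ball 0 1"
    and nonneg: "\<And>\<zeta>. \<zeta> \<in> unit_circle \<Longrightarrow> 0 \<le> Re (twist_speed s n a \<zeta>)"
    and z: "norm z < 1"
  shows "0 < Re (twist_speed s n a z)"
proof (rule ccontr)
  assume neg: "\<not> ?thesis"
  \<comment> \<open>The modulus of \<open>h w\<close> is
    \<open>exp (- Re (twist_speed s n a w))\<close>, so signs of the speed become comparisons of the
    modulus with 1.\<close>
  define h where "h w = exp (- twist_speed s n a w)" for w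
  have nz: "1 - cnj (a k) * w \<noteq> 0" if "k \<in> {1..n}" "norm w \<le> 1" for k w
    using one_minus_cnj_mult_notin_nonpos(2)[of "a k" w] a that by auto
  have hol: "h holomorphic_on ball 0 1"
    unfolding h_def[abs_def] twist_speed_def using nz
    by (auto intro!: holomorphic_intros)
  have cont: "continuous_on (closure (ball 0 1)) h"
    unfolding h_def[abs_def] twist_speed_def using nz
    by (auto intro!: continuous_intros)
  have le1: "norm (h w) \<le> 1" if "w \<in> ball 0 1" for w
  proof (rule maximum_modulus_frontier[of h "ball 0 1"])
    show "norm (h \<zeta>) \<le> 1" if "\<zeta> \<in> frontier (ball 0 1)" for \<zeta>
      using nonneg[of \<zeta>] that by (simp add: h_def)
  qed (use hol cont that in auto)
  have "1 \<le> norm (h z)"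
    using neg by (simp add: h_def)
  then have "h constant_on ball 0 1"
    using le1 z by (intro maximum_modulus_principle[OF hol, of "ball 0 1" z]) (auto intro: order_trans)
  then have "norm (h z) = norm (h 0)"
    using z unfolding constant_on_def by (metis centre_in_ball mem_ball_0 zero_less_one)
  \<comment> \<open>The speed at the origin is 1, so the modulus there is \<open>exp (- 1)\<close>,
    which a constant \<open>h\<close> with modulus at least 1 at \<open>z\<close> cannot
    have.\<close>
  also have "norm (h 0) < 1"
    by (simp add: h_def twist_speed_def)
  finally show False
    using \<open>1 \<le> norm (h z)\<close> by simp
qed

text \<open>The boundedness built into \<open>cfunspace\<close> is automatic on the compact
  circle.\<close>

lemma topspace_CT: "topspace CT = {f \<in> extensional unit_circle. continuous_on unit_circle f}"
proof -
  have "bounded (f ` unit_circle)" if "continuous_on unit_circle f" for f :: "complex \<Rightarrow> complex"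
    using that by (intro compact_imp_bounded compact_continuous_image) auto
  then show ?thesis
    by (auto simp: CT_def)
qed

lemma unit_circle_cis_obtain:
  assumes "\<sigma> \<in> unit_circle"
  obtains \<theta> where "\<sigma> = cis \<theta>"
  using assms by (metis cis_Arg complex_div_cnj dist_0_norm div_by_1 mem_sphere norm_zero of_real_1 sgn_eq zero_neq_one)

text \<open>An injective continuous lift is strictly monotone, and its gain of \<open>2 * pi\<close>
  over a period excludes the decreasing case. Strict growth still allows zeros of the derivative,
  hence only \<le> here.\<close>

lemma Re_twist_speed_nonneg:
  assumes a: "\<forall>k\<in>{1..n}. a k \<in> ball 0 1" and \<sigma>: "\<sigma> \<in> unit_circle"
    and inj: "inj_on (twist s n \<sigma> a) unit_circle" and \<zeta>: "\<zeta> \<in> unit_circle"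
  shows "0 \<le> Re (twist_speed s n a \<zeta>)"
proof -
  let ?\<phi> = "twist_phase s n a"
  obtain c where c: "\<sigma> = cis c" using unit_circle_cis_obtain[OF \<sigma>] .
  obtain \<theta> where \<theta>: "\<zeta> = cis \<theta>" using unit_circle_cis_obtain[OF \<zeta>] .
  have "inj ?\<phi>"
  proof (rule injI)
    fix x y assume xy: "?\<phi> x = ?\<phi> y"
    then have "twist s n \<sigma> a (cis x) = twist s n \<sigma> a (cis y)"
      by (simp add: c twist_cis)
    then have "cis x = cis y"
      using inj by (auto dest: inj_onD)
    then obtain k :: int where "x = y + 2 * pi * of_int k"
      unfolding cis_eq_iff by blast
    with xy show "x = y"
      using twist_phase_plus_2pi_int[of s n a y k] by simp
  qed
  moreover have "\<not> strict_antimono_on UNIV ?\<phi>"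
    using twist_phase_plus_2pi[of s n a 0] monotone_onD[of UNIV "(<)" "(>)" ?\<phi> 0 "2 * pi"] pi_gt_zero
    by fastforce
  ultimately have "strict_mono_on UNIV ?\<phi>"
    using injective_eq_monotone_map[OF _ continuous_on_twist_phase[OF a, of UNIV s]]
    by (simp add: is_interval_univ)
  then have "mono_on UNIV ?\<phi>"
    by (simp add: strict_mono_on_imp_mono_on)
  then show ?thesis
    unfolding \<theta> by (rule mono_on_imp_deriv_nonneg[OF _ has_real_derivative_twist_phase[OF a]]) auto
qed

text \<open>Positive speed makes the lift strictly increasing; being of degree one, it descends to a
  continuous bijection of the circle. Compactness makes the inverse continuous, and the lift also
  gives the winding number.\<close>

lemma restrict_twist_in_H_plus:
  assumes a: "\<forall>k\<in>{1..n}. a k \<in> ball 0 1" and \<sigma>: "\<sigma> \<in> unit_circle"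
    and pos: "\<And>\<zeta>. \<zeta> \<in> unit_circle \<Longrightarrow> 0 < Re (twist_speed s n a \<zeta>)"
  shows "restrict (twist s n \<sigma> a) unit_circle \<in> H_plus"
proof -
  let ?\<phi> = "twist_phase s n a" and ?f = "restrict (twist s n \<sigma> a) unit_circle"
  obtain c where c: "\<sigma> = cis c" using unit_circle_cis_obtain[OF \<sigma>] .
  have mono: "?\<phi> x < ?\<phi> y" if "x < y" for x y
    using that has_real_derivative_twist_phase[OF a, of s] pos
    by (intro DERIV_pos_imp_increasing[of x y ?\<phi>]) (auto intro!: exI)
  have cont: "continuous_on unit_circle ?f"
  proof -
    have "1 - cnj (a k) * \<zeta> \<notin> \<real>\<^sub>\<le>\<^sub>0" if "k \<in> {1..n}" "\<zeta> \<in> unit_circle" for k \<zeta>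
      using one_minus_cnj_mult_notin_nonpos(1)[of "a k" \<zeta>] a that by auto
    then have "continuous_on unit_circle (twist s n \<sigma> a)"
      unfolding twist_def[abs_def] twist_angle_def
      by (intro continuous_intros) auto
    then show ?thesis
      by (rule continuous_on_eq) auto
  qed
  have inj: "inj_on ?f unit_circle"
  proof (rule inj_onI)
    fix w z assume w: "w \<in> unit_circle" and z: "z \<in> unit_circle" and eq: "?f w = ?f z"
    obtain x where x: "w = cis x" using unit_circle_cis_obtain[OF w] .
    obtain y where y: "z = cis y" using unit_circle_cis_obtain[OF z] .
    have "cis (c + ?\<phi> x) = cis (c + ?\<phi> y)"
      using eq by (simp add: x y c twist_cis)
    then obtain k :: int where "?\<phi> x = ?\<phi> y + 2 * pi * of_int k"
      unfolding cis_eq_iff by auto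
    \<comment> \<open>The multiple of \<open>2 * pi\<close> is absorbed into the argument, where
      strict monotonicity can be used.\<close>
    then have "?\<phi> x = ?\<phi> (y + 2 * pi * of_int k)"
      by (simp add: twist_phase_plus_2pi_int)
    then have "x = y + 2 * pi * of_int k"
      using mono by (metis less_irrefl linorder_neqE)
    then show "w = z"
      unfolding x y cis_eq_iff by blast
  qed
  have surj: "?f ` unit_circle = unit_circle"
  proof
    show "?f ` unit_circle \<subseteq> unit_circle"
      using norm_twist[OF \<sigma>] by auto
    show "unit_circle \<subseteq> ?f ` unit_circle"
    proof
      fix w assume w: "w \<in> unit_circle"
      obtain y where y: "w = cis y" using unit_circle_cis_obtain[OF w] .
      \<comment> \<open>The floor selects the translate \<open>v\<close> of \<open>y - c\<close>
        lying in the range of the lift over one period, where the intermediate value theorem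
        applies.\<close>
      define k where "k = \<lfloor>(y - c - ?\<phi> 0) / (2 * pi)\<rfloor>"
      define v where "v = y - c - 2 * pi * of_int k"
      have "of_int k * (2 * pi) \<le> y - c - ?\<phi> 0" "y - c - ?\<phi> 0 \<le> (of_int k + 1) * (2 * pi)"
        unfolding k_def using pi_gt_zero
        by (simp_all flip: pos_le_divide_eq pos_divide_le_eq)
      then have "?\<phi> 0 \<le> v" "v \<le> ?\<phi> (2 * pi)"
        using twist_phase_plus_2pi[of s n a 0] by (auto simp: v_def algebra_simps)
      then obtain x where "?\<phi> x = v"
        using IVT'[of ?\<phi> 0 v "2 * pi"] continuous_on_twist_phase[OF a] by auto
      then have "?f (cis x) = cis (y - 2 * pi * of_int k)"
        by (simp add: c twist_cis v_def)
      also have "\<dots> = w"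
        unfolding y cis_eq_iff by (intro exI[of _ "-k"]) simp
      finally show "w \<in> ?f ` unit_circle"
        by (intro image_eqI[of _ _ "cis x"]) auto
    qed
  qed
  have hom: "homeomorphic_map (top_of_set unit_circle) (top_of_set unit_circle) ?f"
    using cont inj surj
    by (intro continuous_imp_homeomorphic_map) (auto simp: compact_space_subtopology Hausdorff_space_subtopology)
  \<comment> \<open>A continuous logarithm of the image path; its increment
    \<open>2 * pi * \<i>\<close> gives winding number 1.\<close>
  define p where "p x = \<i> * of_real (c + ?\<phi> (2 * pi * x))" for x
  have circ: "circlepath 0 1 x = cis (2 * pi * x)" for x
    by (simp add: circlepath cis_conv_exp algebra_simps)
  have exp_p: "exp (p x) = cis (c + ?\<phi> (2 * pi * x))" for x
    by (simp only: p_def cis_conv_exp)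
  have "?f \<circ> circlepath 0 1 = exp \<circ> p"
    by (simp add: fun_eq_iff circ c twist_cis exp_p)
  moreover have "path p"
    unfolding path_def p_def
    by (intro continuous_intros continuous_on_compose2[OF continuous_on_twist_phase[OF a, of UNIV]]) auto
  ultimately have "winding_number (?f \<circ> circlepath 0 1) 0 = 1"
    using twist_phase_plus_2pi[of s n a 0]
    by (simp add: winding_number_compose_exp pathfinish_def pathstart_def p_def field_simps)
  with hom cont show ?thesis
    by (simp add: H_plus_def topspace_CT)
qed

section \<open>Uniqueness of the zeros\<close>

text \<open>
  The \<open>b k\<close> are allowed on the boundary of the disk, since they arise as limits of parameters. The
  factors \<open>1 - cnj c * z\<close> have no zeros in the open disk, so comparing orders there identifies the
  parameters.
\<close>
lemma blaschke_parameters_unique: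
  fixes a b :: "nat \<Rightarrow> complex"
  assumes \<sigma>: "\<sigma> \<noteq> 0" and \<tau>: "\<tau> \<noteq> 0"
    and a: "\<forall>k\<in>{1..n}. a k \<in> ball 0 1" and b: "\<forall>k\<in>{1..n}. b k \<in> cball 0 1"
    and inf: "infinite Z"
    and eq: "\<And>z. z \<in> Z \<Longrightarrow>
      \<sigma> * (\<Prod>k=1..n. z - a k) * (\<Prod>k=1..n. 1 - cnj (b k) * z) =
      \<tau> * (\<Prod>k=1..n. z - b k) * (\<Prod>k=1..n. 1 - cnj (a k) * z)"
  shows "image_mset a (mset_set {1..n}) = image_mset b (mset_set {1..n})"
proof -
  \<comment> \<open>\<open>R c\<close> has the \<open>c k\<close> as its roots with multiplicity,
    and \<open>S c\<close> is the product of the denominators.\<close>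
  define R where "R c = (\<Prod>k=1..n. [:- c k, 1:])" for c :: "nat \<Rightarrow> complex"
  define S where "S c = (\<Prod>k=1..n. [:1, - cnj (c k):])" for c :: "nat \<Rightarrow> complex"
  have R0: "R c \<noteq> 0" and S0: "S c \<noteq> 0" for c
    by (auto simp: R_def S_def)
  have R_roots: "proots (R c) = image_mset c (mset_set {1..n})" for c
    unfolding R_def by (subst proots_prod) (auto simp: sum_unfold_sum_mset)
  have S_order: "order z (S c) = 0" if "\<forall>k\<in>{1..n}. c k \<in> cball 0 1" "norm z < 1" for c z
  proof -
    have "poly (S c) z \<noteq> 0"
    proof
      assume "poly (S c) z = 0"
      then obtain k where k: "k \<in> {1..n}" "1 - z * cnj (c k) = 0"
        by (auto simp: S_def poly_prod)
      then have "norm z * norm (c k) = 1"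
        by (metis complex_mod_cnj eq_iff_diff_eq_0 norm_mult norm_one)
      moreover have "norm z * norm (c k) \<le> norm z * 1"
        using that k by (intro mult_left_mono) auto
      ultimately show False using that by simp
    qed
    then show ?thesis by (rule order_0I)
  qed
  have "smult \<sigma> (R a * S b) = smult \<tau> (R b * S a)"
  proof (rule ccontr)
    assume "\<not> ?thesis"
    then have "finite {z. poly (smult \<sigma> (R a * S b) - smult \<tau> (R b * S a)) z = 0}"
      by (intro poly_roots_finite) simp
    moreover have "Z \<subseteq> {z. poly (smult \<sigma> (R a * S b) - smult \<tau> (R b * S a)) z = 0}"
    proof
      fix z assume "z \<in> Z"
      from eq[OF this] show "z \<in> {z. poly (smult \<sigma> (R a * S b) - smult \<tau> (R b * S a)) z = 0}"
        by (simp add: R_def S_def poly_prod mult.assoc mult.commute[of z])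
    qed
    ultimately show False using inf finite_subset by blast
  qed
  then have "order z (R a * S b) = order z (R b * S a)" for z
    using \<sigma> \<tau> by (metis order_smult)
  then have ord: "order z (R a) + order z (S b) = order z (R b) + order z (S a)" for z
    using R0 S0 by (simp add: order_mult)
  \<comment> \<open>Comparing orders in the open disk gives only an inclusion, since roots of
    \<open>R b\<close> on the circle are not controlled. Both multisets have \<open>n\<close>
    elements, which makes it an equality.\<close>
  have "proots (R a) \<subseteq># proots (R b)"
  proof (rule mset_subset_eqI)
    fix z
    show "count (proots (R a)) z \<le> count (proots (R b)) z"
    proof (cases "norm z < 1")
      case True
      have "order z (S a) = 0" "order z (S b) = 0"
        using a b True by (auto intro!: S_order simp: less_eq_real_def)
      then show ?thesis
        using ord[of z] R0 by simp
    next
      case False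
      then have "z \<notin># proots (R a)"
        using a unfolding R_roots by auto
      then show ?thesis by (simp add: not_in_iff)
    qed
  qed
  moreover have "size (proots (R a)) = size (proots (R b))"
    unfolding R_roots by simp
  ultimately have "proots (R a) = proots (R b)"
    using mset_subset_size by (metis less_irrefl subset_mset.le_less)
  then show ?thesis
    unfolding R_roots .
qed

text \<open>The zeros are recovered only up to order, but the sum is symmetric in them. The factor
  \<open>c\<close> covers scaled zeros.\<close>

lemma twist_angle_cong_mset:
  assumes "image_mset a (mset_set {1..n}) = image_mset b (mset_set {1..n})"
  shows "twist_angle n (\<lambda>k. c * a k) \<zeta> = twist_angle n (\<lambda>k. c * b k) \<zeta>"
proof -
  have *: "twist_angle n (\<lambda>k. c * d k) \<zeta> =
      sum_mset (image_mset (\<lambda>x. Im (Ln (1 - cnj (c * x) * \<zeta>))) (image_mset d (mset_set {1..n})))" for d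
    by (simp add: twist_angle_def sum_unfold_sum_mset image_mset.compositionality o_def)
  show ?thesis
    unfolding * assms ..
qed

text \<open>Joint continuity in rotation, zeros and point. The branch cut must be avoided at the
  limit only, so limits of zeros may reach the circle.\<close>

lemma tendsto_twist:
  assumes "(S \<longlongrightarrow> \<sigma>) F" "\<And>k. k \<in> {1..n} \<Longrightarrow> ((\<lambda>j. A j k) \<longlongrightarrow> a k) F" "(Z \<longlongrightarrow> \<zeta>) F"
    and "\<And>k. k \<in> {1..n} \<Longrightarrow> 1 - cnj (a k) * \<zeta> \<notin> \<real>\<^sub>\<le>\<^sub>0"
  shows "((\<lambda>j. twist s n (S j) (A j) (Z j)) \<longlongrightarrow> twist s n \<sigma> a \<zeta>) F"
proof -
  have "((\<lambda>j. twist_angle n (A j) (Z j)) \<longlongrightarrow> twist_angle n a \<zeta>) F"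
    unfolding twist_angle_def by (intro tendsto_intros assms) auto
  then show ?thesis
    unfolding twist_def cis_conv_exp by (intro tendsto_intros assms)
qed

text \<open>Because of this, removing the finitely many points \<open>a k\<close> from the circle
  keeps all denominators nonzero.\<close>

lemma one_minus_cnj_mult_eq_0_imp:
  assumes "\<zeta> \<in> unit_circle" "1 - cnj a * \<zeta> = 0"
  shows "\<zeta> = a"
  using blaschke_factor_on_circle[OF assms(1), of a] assms(2) by simp

lemma twist_reflect:
  assumes "\<sigma> \<in> unit_circle" "\<tau> \<in> unit_circle" "\<zeta> \<in> unit_circle"
    and "twist (- s) n \<sigma> a \<zeta> = twist (- s) n \<tau> b \<zeta>"
  shows "twist s n (cnj \<sigma>) a \<zeta> = twist s n (cnj \<tau>) b \<zeta>"
proof -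
  have "twist (- s) n \<sigma> a \<zeta> \<noteq> 0"
    using norm_twist[OF assms(1,3)] by (metis norm_zero zero_neq_one)
  moreover have "twist (- s) n \<sigma> a \<zeta> * twist s n (cnj \<sigma>) a \<zeta> =
      twist (- s) n \<sigma> a \<zeta> * twist s n (cnj \<tau>) b \<zeta>"
    using twist_minus[OF assms(1,3), of "- s" n a] twist_minus[OF assms(2,3), of "- s" n b] assms(4)
    by simp
  ultimately show ?thesis by simp
qed

text \<open>Clearing denominators reduces this to \<open>blaschke_parameters_unique\<close>. It
  serves two purposes: limits of zeros cannot escape to the circle, and the scaled map does not
  depend on the parameters chosen to represent a function.\<close>

lemma twist_parameters_unique:
  assumes s: "s = 1 \<or> s = -1" and \<sigma>: "\<sigma> \<in> unit_circle" and \<tau>: "\<tau> \<in> unit_circle"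
    and a: "\<forall>k\<in>{1..n}. a k \<in> cball 0 1" and b: "\<forall>k\<in>{1..n}. b k \<in> ball 0 1"
    and eq: "\<And>\<zeta>. \<zeta> \<in> unit_circle - a ` {1..n} \<Longrightarrow> twist s n \<sigma> a \<zeta> = twist s n \<tau> b \<zeta>"
  shows "\<forall>k\<in>{1..n}. a k \<in> ball 0 1"
    and "twist s n \<sigma> (\<lambda>k. c * a k) = twist s n \<tau> (\<lambda>k. c * b k)"
proof -
  define Z where "Z = unit_circle - a ` {1..n}"
  have inf: "infinite Z"
  proof -
    have "infinite (unit_circle :: complex set)"
    proof
      assume "finite (unit_circle :: complex set)"
      then obtain c :: complex where "unit_circle = {c}"
        using connected_finite_iff_sing[OF connected_sphere[of "0::complex" 1]] by auto
      moreover have "1 \<in> unit_circle" "-1 \<in> unit_circle" by auto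
      ultimately show False by (metis equal_neg_zero singletonD zero_neq_one one_neq_neg_one)
    qed
    then show ?thesis unfolding Z_def by (simp add: Diff_infinite_finite)
  qed
  \<comment> \<open>For \<open>s = -1\<close>, \<open>twist_reflect\<close> conjugates the rotations
    and leads back to the case \<open>s = 1\<close>.\<close>
  obtain \<sigma>' \<tau>' where \<sigma>': "\<sigma>' \<in> unit_circle" and \<tau>': "\<tau>' \<in> unit_circle"
    and eq1: "\<And>\<zeta>. \<zeta> \<in> Z \<Longrightarrow> twist 1 n \<sigma>' a \<zeta> = twist 1 n \<tau>' b \<zeta>"
    using s
  proof
    assume "s = 1"
    with that \<sigma> \<tau> eq show thesis unfolding Z_def by blast
  next
    assume "s = -1"
    with eq twist_reflect[OF \<sigma> \<tau>, of _ 1 n a b] that[of "cnj \<sigma>" "cnj \<tau>"] \<sigma> \<tau> show thesis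
      unfolding Z_def by auto
  qed
  have mset: "image_mset b (mset_set {1..n}) = image_mset a (mset_set {1..n})"
  proof (rule blaschke_parameters_unique[OF _ _ b a inf])
    show "\<tau>' \<noteq> 0" "\<sigma>' \<noteq> 0" using \<sigma>' \<tau>' by auto
    fix z assume z: "z \<in> Z"
    then have z': "z \<in> unit_circle" "z \<noteq> 0" by (auto simp: Z_def)
    have nza: "1 - cnj (a k) * z \<noteq> 0" if "k \<in> {1..n}" for k
      using one_minus_cnj_mult_eq_0_imp[OF z'(1), of "a k"] z that by (auto simp: Z_def)
    have nzb: "1 - cnj (b k) * z \<noteq> 0" if "k \<in> {1..n}" for k
      using b z' that by (intro one_minus_cnj_mult_nonzero) auto
    have "\<sigma>' * (\<Prod>k=1..n. (z - a k) / (1 - cnj (a k) * z)) =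
          \<tau>' * (\<Prod>k=1..n. (z - b k) / (1 - cnj (b k) * z))"
      using twist_eq_blaschke[where n = n and a = a and \<sigma> = \<sigma>', OF z'(1) nza] twist_eq_blaschke[where n = n and a = b and \<sigma> = \<tau>', OF z'(1) nzb] eq1[OF z] z'(2)
      by simp
    then show "\<tau>' * (\<Prod>k=1..n. z - b k) * (\<Prod>k=1..n. 1 - cnj (a k) * z) =
      \<sigma>' * (\<Prod>k=1..n. z - a k) * (\<Prod>k=1..n. 1 - cnj (b k) * z)"
      using nza nzb by (simp add: prod_dividef frac_eq_eq)
  qed
  show "\<forall>k\<in>{1..n}. a k \<in> ball 0 1"
  proof
    fix k assume "k \<in> {1..n}"
    then have "a k \<in># image_mset b (mset_set {1..n})"
      unfolding mset by simp
    then show "a k \<in> ball 0 1"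
      using b by auto
  qed
  have ang: "twist_angle n (\<lambda>k. c * a k) = twist_angle n (\<lambda>k. c * b k)" for c
    using twist_angle_cong_mset[OF mset] by (auto simp: fun_eq_iff)
  \<comment> \<open>The angles already agree, so a single point of agreement determines the
    rotation.\<close>
  obtain \<zeta> where \<zeta>: "\<zeta> \<in> Z" using inf by (metis finite.emptyI ex_in_conv)
  then have "\<sigma> = \<tau>"
    using eq[of \<zeta>] ang[of 1] by (auto simp: twist_def Z_def)
  with ang show "twist s n \<sigma> (\<lambda>k. c * a k) = twist s n \<tau> (\<lambda>k. c * b k)"
    by (simp add: fun_eq_iff twist_def)
qed

section \<open>Continuity of the scaling in the supremum norm\<close>

text \<open>Tychonoff's theorem. The product is countable, hence metrizable, so compactness yields
  convergent subsequences of zeros.\<close>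

lemma compact_polydisk: "compact {a :: nat \<Rightarrow> complex. \<forall>k. a k \<in> cball 0 1}"
proof -
  have "compactin (product_topology (\<lambda>_. euclidean) UNIV) (PiE UNIV (\<lambda>_::nat. cball 0 1 :: complex set))"
    unfolding compactin_PiE by simp
  then show ?thesis
    by (simp add: euclidean_product_topology PiE_UNIV_domain Pi_def)
qed

lemma twist_cong: "(\<And>k. k \<in> {1..n} \<Longrightarrow> a k = b k) \<Longrightarrow> twist s n \<sigma> a = twist s n \<sigma> b"
  by (simp add: fun_eq_iff twist_def twist_angle_def)

text \<open>Quantifying over all parameters \<sigma>, \<open>a\<close> of the nearby function
  removes any need to choose them continuously. A failure for every \<delta> would give a sequence
  of parameters whose limit contradicts uniqueness.\<close>

lemma twist_scaling_continuous:
  assumes s: "s = 1 \<or> s = -1" and \<tau>: "\<tau> \<in> unit_circle" and b: "\<forall>k\<in>{1..n}. b k \<in> ball 0 1"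
    and t: "t \<in> {0..1::real}" and \<epsilon>: "0 < \<epsilon>"
  shows "\<exists>\<delta>>0. \<forall>\<sigma> a u. \<sigma> \<in> unit_circle \<longrightarrow> (\<forall>k\<in>{1..n}. a k \<in> ball 0 1) \<longrightarrow> u \<in> {0..1} \<longrightarrow>
           \<bar>u - t\<bar> < \<delta> \<longrightarrow>
           (\<forall>\<zeta>\<in>unit_circle. dist (twist s n \<sigma> a \<zeta>) (twist s n \<tau> b \<zeta>) < \<delta>) \<longrightarrow>
           (\<forall>\<zeta>\<in>unit_circle. dist (twist s n \<sigma> (\<lambda>k. of_real u * a k) \<zeta>)
              (twist s n \<tau> (\<lambda>k. of_real t * b k) \<zeta>) < \<epsilon>)"
proof (rule ccontr)
  let ?K = "unit_circle \<times> {a :: nat \<Rightarrow> complex. \<forall>k. a k \<in> cball 0 1} \<times> {0..1::real} \<times> unit_circle"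
  let ?T = "\<lambda>\<sigma> u a. twist s n \<sigma> (\<lambda>k. of_real u * a k)"
  define C where "C \<delta> \<sigma> a u \<longleftrightarrow> \<sigma> \<in> unit_circle \<and> (\<forall>k\<in>{1..n}. a k \<in> ball 0 1) \<and> u \<in> {0..1} \<and>
      \<bar>u - t\<bar> < \<delta> \<and> (\<forall>\<zeta>\<in>unit_circle. dist (twist s n \<sigma> a \<zeta>) (twist s n \<tau> b \<zeta>) < \<delta>)" for \<delta> \<sigma> a u
  define D where "D \<sigma> a u \<zeta> = dist (?T \<sigma> u a \<zeta>) (?T \<tau> t b \<zeta>)" for \<sigma> a u \<zeta>
  assume "\<not> ?thesis"
  then have neg: "\<nexists>\<delta>. \<delta> > 0 \<and> (\<forall>\<sigma> a u. C \<delta> \<sigma> a u \<longrightarrow> (\<forall>\<zeta>\<in>unit_circle. D \<sigma> a u \<zeta> < \<epsilon>))"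
    unfolding C_def D_def by simp
  \<comment> \<open>\<open>G j p\<close> says that \<open>p\<close> violates the claim for \<delta>
    equal to \<open>1 / (j + 1)\<close>. The point \<zeta> of violation is kept in the tuple so that
    it converges along with the parameters.\<close>
  define G where "G j p \<longleftrightarrow> (case p of (\<sigma>, a, u, \<zeta>) \<Rightarrow> \<bar>u - t\<bar> < inverse (real (Suc j)) \<and>
      (\<forall>\<zeta>\<in>unit_circle. dist (twist s n \<sigma> a \<zeta>) (twist s n \<tau> b \<zeta>) < inverse (real (Suc j))) \<and>
      \<epsilon> \<le> dist (?T \<sigma> u a \<zeta>) (?T \<tau> t b \<zeta>))" for j p
  have "\<exists>p. p \<in> ?K \<and> G j p" for j
  proof -
    have "inverse (real (Suc j)) > 0" by simp
    with neg obtain \<sigma> a u \<zeta> where "C (inverse (real (Suc j))) \<sigma> a u" "\<zeta> \<in> unit_circle" "\<not> D \<sigma> a u \<zeta> < \<epsilon>"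
      by blast
    then have *: "\<sigma> \<in> unit_circle" "\<forall>k\<in>{1..n}. a k \<in> ball 0 1" "u \<in> {0..1}"
        "\<bar>u - t\<bar> < inverse (real (Suc j))"
        "\<forall>\<zeta>\<in>unit_circle. dist (twist s n \<sigma> a \<zeta>) (twist s n \<tau> b \<zeta>) < inverse (real (Suc j))"
        "\<zeta> \<in> unit_circle" "\<epsilon> \<le> dist (?T \<sigma> u a \<zeta>) (?T \<tau> t b \<zeta>)"
      unfolding C_def D_def by (simp_all add: not_less)
    \<comment> \<open>Indices outside \<open>{1..n}\<close> are reset to 0, so that the whole
      function lies in the compact polydisk.\<close>
    define a' where "a' k = (if k \<in> {1..n} then a k else 0)" for k
    have tw: "twist s n \<sigma> a' = twist s n \<sigma> a" "?T \<sigma> u a' = ?T \<sigma> u a"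
      by (rule twist_cong; simp add: a'_def)+
    have "\<forall>k. a' k \<in> cball 0 1"
      using *(2) by (auto simp: a'_def intro: less_imp_le)
    then show ?thesis
      using * by (intro exI[of _ "(\<sigma>, a', u, \<zeta>)"]) (simp_all add: tw G_def)
  qed
  then obtain X where X: "\<And>j. X j \<in> ?K" and X': "\<And>j. G j (X j)"
    by metis
  have "compact ?K"
    by (intro compact_Times compact_polydisk) auto
  then obtain l r where l: "l \<in> ?K" and r: "strict_mono r" and lim: "(X \<circ> r) \<longlonglongrightarrow> l"
    unfolding compact_def using X by meson
  obtain \<sigma> a u \<zeta> where l_eq: "l = (\<sigma>, a, u, \<zeta>)" by (cases l)
  define S A U Z where "S j = fst (X (r j))" and "A j = fst (snd (X (r j)))"
    and "U j = fst (snd (snd (X (r j))))" and "Z j = snd (snd (snd (X (r j))))" for j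
  have Xr: "X (r j) = (S j, A j, U j, Z j)" for j
    by (simp add: S_def A_def U_def Z_def)
  have lim': "(\<lambda>j. (S j, A j, U j, Z j)) \<longlonglongrightarrow> (\<sigma>, a, u, \<zeta>)"
    using lim unfolding l_eq o_def Xr .
  have S: "S \<longlonglongrightarrow> \<sigma>" and A: "A \<longlonglongrightarrow> a" and U: "U \<longlonglongrightarrow> u" and Z: "Z \<longlonglongrightarrow> \<zeta>"
    using tendsto_fst[OF lim'] tendsto_fst[OF tendsto_snd[OF lim']]
      tendsto_fst[OF tendsto_snd[OF tendsto_snd[OF lim']]]
      tendsto_snd[OF tendsto_snd[OF tendsto_snd[OF lim']]] by simp_all
  have Ak: "(\<lambda>j. A j k) \<longlonglongrightarrow> a k" for k
  proof (rule isCont_tendsto_compose[OF _ A, of "\<lambda>f. f k"])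
    show "isCont (\<lambda>f. f k) a"
      using continuous_on_product_coordinates[of k]
      by (metis UNIV_I continuous_on_eq_continuous_at open_UNIV)
  qed
  have lK: "\<sigma> \<in> unit_circle" "\<And>k. a k \<in> cball 0 1" "\<zeta> \<in> unit_circle"
    using l by (auto simp: l_eq)
  have lim0: "(\<lambda>j. inverse (real (Suc (r j)))) \<longlonglongrightarrow> 0"
    using LIMSEQ_subseq_LIMSEQ[OF LIMSEQ_inverse_real_of_nat r] by (simp add: o_def)
  have close: "\<bar>U j - t\<bar> < inverse (real (Suc (r j)))"
      "\<And>z. z \<in> unit_circle \<Longrightarrow> dist (twist s n (S j) (A j) z) (twist s n \<tau> b z) < inverse (real (Suc (r j)))"
      "\<epsilon> \<le> dist (?T (S j) (U j) (A j) (Z j)) (?T \<tau> t b (Z j))" for j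
    using X'[of "r j"] by (simp_all add: Xr G_def)
  have "U \<longlonglongrightarrow> t"
    by (rule Lim_transform_bound[THEN LIM_zero_cancel, OF _ lim0])
       (use close(1) in \<open>auto simp: less_imp_le intro!: always_eventually\<close>)
  with U have u: "u = t" by (rule LIMSEQ_unique)
  have pointwise: "(\<lambda>j. twist s n (S j) (A j) z) \<longlonglongrightarrow> twist s n \<tau> b z" if "z \<in> unit_circle" for z
  proof (rule tendsto_dist_iff[THEN iffD2], rule Lim_null_comparison[OF always_eventually lim0], rule allI)
    show "norm (dist (twist s n (S j) (A j) z) (twist s n \<tau> b z)) \<le> inverse (real (Suc (r j)))" for j
      using close(2)[OF that, of j] by (simp only: real_norm_def abs_of_nonneg zero_le_dist less_imp_le)
  qed
  \<comment> \<open>Away from the limit zeros the twist is continuous in its parameters, so the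
    pointwise limit is computed in two ways.\<close>
  have eq: "twist s n \<sigma> a z = twist s n \<tau> b z" if z: "z \<in> unit_circle - a ` {1..n}" for z
  proof -
    have "1 - cnj (a k) * z \<notin> \<real>\<^sub>\<le>\<^sub>0" if k: "k \<in> {1..n}" for k
    proof -
      have "norm (cnj (a k) * z) \<le> 1"
        using lK(2)[of k] z by (simp add: norm_mult)
      moreover have "cnj (a k) * z \<noteq> 1"
        using one_minus_cnj_mult_eq_0_imp[of z "a k"] z k by auto
      ultimately have "0 < Re (1 - cnj (a k) * z)"
        by (rule Re_one_minus_pos)
      then show ?thesis
        by (auto simp: complex_nonpos_Reals_iff)
    qed
    then have "(\<lambda>j. twist s n (S j) (A j) z) \<longlonglongrightarrow> twist s n \<sigma> a z"
      by (intro tendsto_twist S Ak tendsto_const)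
    with pointwise[of z] z show ?thesis
      using LIMSEQ_unique by blast
  qed
  \<comment> \<open>Uniqueness puts the limit zeros into the open disk and identifies the two limits
    of the scaled maps.\<close>
  have a: "\<forall>k\<in>{1..n}. a k \<in> ball 0 1" and T_eq: "?T \<sigma> t a = ?T \<tau> t b"
    using twist_parameters_unique[OF s lK(1) \<tau> _ b eq] lK(2) by auto
  have ball_t: "of_real t * d k \<in> ball 0 1" if "\<forall>k\<in>{1..n}. d k \<in> ball 0 1" "k \<in> {1..n}" for d :: "nat \<Rightarrow> complex" and k
  proof -
    have "\<bar>t\<bar> * norm (d k) \<le> 1 * norm (d k)"
      using t by (intro mult_right_mono) auto
    with that show ?thesis by (force simp: norm_mult)
  qed
  have lim1: "(\<lambda>j. ?T (S j) (U j) (A j) (Z j)) \<longlonglongrightarrow> ?T \<sigma> t a \<zeta>"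
  proof (rule tendsto_twist[OF S _ Z])
    show "(\<lambda>j. of_real (U j) * A j k) \<longlonglongrightarrow> of_real t * a k" for k
      using U Ak unfolding u by (intro tendsto_intros)
    show "1 - cnj (of_real t * a k) * \<zeta> \<notin> \<real>\<^sub>\<le>\<^sub>0" if "k \<in> {1..n}" for k
      using lK(3) ball_t[OF a that] by (intro one_minus_cnj_mult_notin_nonpos(1)) auto
  qed
  have lim2: "(\<lambda>j. ?T \<tau> t b (Z j)) \<longlonglongrightarrow> ?T \<tau> t b \<zeta>"
  proof (rule tendsto_twist[OF tendsto_const tendsto_const Z])
    show "1 - cnj (of_real t * b k) * \<zeta> \<notin> \<real>\<^sub>\<le>\<^sub>0" if "k \<in> {1..n}" for k
      using lK(3) ball_t[OF b that] by (intro one_minus_cnj_mult_notin_nonpos(1)) auto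
  qed
  \<comment> \<open>Both sequences tend to the same value although their distance never drops below
    \<epsilon>.\<close>
  have "\<epsilon> \<le> dist (?T \<tau> t b \<zeta>) (?T \<tau> t b \<zeta>)"
    using tendsto_dist[OF lim1[unfolded T_eq] lim2] close(3) by (rule LIMSEQ_le_const[OF _ exI[of _ 0], rule_format])
  with \<epsilon> show False by simp
qed

text \<open>Distance in \<open>CT\<close> is uniform distance on the circle, and the product
  topology is metrized by \<open>prod_dist\<close>; this turns continuity into a condition free of
  metric-space machinery.\<close>

lemma continuous_map_into_CT:
  assumes X: "X \<subseteq> topspace CT"
    and F: "\<And>f t. f \<in> X \<Longrightarrow> t \<in> {0..1} \<Longrightarrow> F (f, t) \<in> X"
    and close: "\<And>f t \<epsilon>. f \<in> X \<Longrightarrow> t \<in> {0..1::real} \<Longrightarrow> \<epsilon> > 0 \<Longrightarrow>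
      \<exists>\<delta>>0. \<forall>g u. g \<in> X \<longrightarrow> u \<in> {0..1} \<longrightarrow> \<bar>u - t\<bar> < \<delta> \<longrightarrow>
        (\<forall>\<zeta>\<in>unit_circle. dist (g \<zeta>) (f \<zeta>) < \<delta>) \<longrightarrow>
        (\<forall>\<zeta>\<in>unit_circle. dist (F (g, u) \<zeta>) (F (f, t) \<zeta>) < \<epsilon>)"
  shows "continuous_map (prod_topology (subtopology CT X) (top_of_set {0..1})) (subtopology CT X) F"
proof -
  define m where "m = cfunspace (top_of_set unit_circle) (euclidean_metric :: complex metric)"
  define mX where "mX = submetric m X"
  define mI where "mI = submetric (euclidean_metric :: real metric) {0..1}"
  have CT: "CT = mtopology_of m"
    by (simp add: CT_def m_def)
  have Xm: "X \<subseteq> mspace m"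
    using X by (simp add: CT)
  then have mspace_mX: "mspace mX = X" and mspace_mI: "mspace mI = {0..1}"
    by (auto simp: mX_def mI_def)
  interpret P: Metric_space12 "mspace mX" "mdist mX" "mspace mI" "mdist mI"
    by (rule Metric_space12_mspace_mdist)
  have top_X: "subtopology CT X = P.M1.mtopology"
    unfolding CT mX_def mtopology_of_submetric[symmetric] by (simp add: mtopology_of_def)
  have top_I: "top_of_set {0..1} = P.M2.mtopology"
    using mtopology_of_submetric[of euclidean_metric "{0..1::real}"]
    by (simp add: mI_def mtopology_of_def)
  show ?thesis
    unfolding top_X top_I P.mtopology_prod_metric[symmetric]
      P.Prod_metric.metric_continuous_map[OF P.M1.Metric_space_axioms]
  proof (intro conjI ballI allI impI)
    show "F ` (mspace mX \<times> mspace mI) \<subseteq> mspace mX"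
      using F by (auto simp: mspace_mX mspace_mI)
    fix p and \<epsilon> :: real assume "p \<in> mspace mX \<times> mspace mI" and \<epsilon>: "\<epsilon> > 0"
    then obtain f t where p: "p = (f, t)" "f \<in> X" "t \<in> {0..1}"
      by (auto simp: mspace_mX mspace_mI)
    obtain \<delta> where \<delta>: "\<delta> > 0" and close': "\<And>g u. g \<in> X \<Longrightarrow> u \<in> {0..1} \<Longrightarrow> \<bar>u - t\<bar> < \<delta> \<Longrightarrow>
        (\<forall>\<zeta>\<in>unit_circle. dist (g \<zeta>) (f \<zeta>) < \<delta>) \<Longrightarrow>
        (\<forall>\<zeta>\<in>unit_circle. dist (F (g, u) \<zeta>) (F (f, t) \<zeta>) < \<epsilon> / 2)"
      \<comment> \<open>Pointwise strict bounds give only a weak bound for the supremum, hence the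
        use of half of \<epsilon>.\<close>
      using close[OF p(2,3), of "\<epsilon> / 2"] \<epsilon> by auto
    show "\<exists>\<delta>>0. \<forall>q. q \<in> mspace mX \<times> mspace mI \<and> prod_dist (mdist mX) (mdist mI) p q < \<delta> \<longrightarrow>
        mdist mX (F p) (F q) < \<epsilon>"
    proof (intro exI conjI allI impI)
      fix q assume q: "q \<in> mspace mX \<times> mspace mI \<and> prod_dist (mdist mX) (mdist mI) p q < \<delta>"
      then obtain g u where gu: "q = (g, u)" "g \<in> X" "u \<in> {0..1}"
        by (auto simp: mspace_mX mspace_mI)
      have "mdist mX f g < \<delta>" "mdist mI t u < \<delta>"
        using q P.component_le_prod_metric[where ?x1.0=f and ?x2.0=g and ?y1.0=t and ?y2.0=u]
        by (auto simp: p gu intro: le_less_trans)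
      then have d: "mdist m f g < \<delta>" "\<bar>u - t\<bar> < \<delta>"
        by (auto simp: mX_def mI_def dist_real_def)
      have "dist (g \<zeta>) (f \<zeta>) < \<delta>" if "\<zeta> \<in> unit_circle" for \<zeta>
        using cfunspace_mdist_lt[of "top_of_set unit_circle" f euclidean_metric g \<delta> \<zeta>] d(1) p gu Xm that
        unfolding m_def by (auto simp: dist_commute compactin_subtopology)
      then have "\<forall>\<zeta>\<in>unit_circle. dist (F (g, u) \<zeta>) (F (f, t) \<zeta>) < \<epsilon> / 2"
        using close' gu d by blast
      then have "mdist m (F (f, t)) (F (g, u)) \<le> \<epsilon> / 2"
        unfolding m_def using \<epsilon>
        by (intro mdist_cfunspace_le) (auto simp: dist_commute less_imp_le)
      then show "mdist mX (F p) (F q) < \<epsilon>"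
        using \<epsilon> by (simp add: p gu mX_def)
    qed (fact \<delta>)
  qed
qed

section \<open>The deformation onto the rotations\<close>

lemma twist_zero: "twist s n \<sigma> (\<lambda>k. 0) = (\<lambda>\<zeta>. \<sigma> * \<zeta>)"
  by (simp add: fun_eq_iff twist_def twist_angle_def)

text \<open>With all zeros at the origin the twist is a rotation and its speed is identically
  1.\<close>

lemma SO2_subset_twist_family: "SO2 \<subseteq> twist_family s n"
proof
  fix f assume "f \<in> SO2"
  then obtain \<sigma> where \<sigma>: "\<sigma> \<in> unit_circle" and f: "f = restrict (twist s n \<sigma> (\<lambda>k. 0)) unit_circle"
    by (auto simp: SO2_def twist_zero)
  moreover have "f \<in> H_plus"
    unfolding f using \<sigma> by (intro restrict_twist_in_H_plus) (auto simp: twist_speed_def)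
  ultimately show "f \<in> twist_family s n"
    unfolding twist_family_def by fastforce
qed

lemma SO2_deformation_retract_of_twist_family:
  assumes s: "s = 1 \<or> s = -1"
  shows "SO2 deformation_retract_of_space (subtopology CT (twist_family s n))"
proof -
  define X where "X = twist_family s n"
  let ?par = "\<lambda>p f. fst p \<in> unit_circle \<and> (\<forall>k\<in>{1..n}. snd p k \<in> ball 0 1) \<and>
    f = restrict (twist s n (fst p) (snd p)) unit_circle"
  \<comment> \<open>An arbitrary choice of parameters, with no continuity required of it:
    \<open>twist_scaling_continuous\<close> holds for every choice.\<close>
  define par where "par f = (SOME p. ?par p f)" for f
  define F where "F = (\<lambda>(f, t). restrict (twist s n (fst (par f)) (\<lambda>k. of_real t * snd (par f) k)) unit_circle)"
  have X_top: "X \<subseteq> topspace CT"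
    by (auto simp: X_def twist_family_def H_plus_def)
  have par: "fst (par f) \<in> unit_circle" "\<forall>k\<in>{1..n}. snd (par f) k \<in> ball 0 1"
     "f = restrict (twist s n (fst (par f)) (snd (par f))) unit_circle" if "f \<in> X" for f
  proof -
    from that have "\<exists>p. ?par p f"
      by (auto simp: X_def twist_family_def)
    from someI_ex[OF this] show "fst (par f) \<in> unit_circle" "\<forall>k\<in>{1..n}. snd (par f) k \<in> ball 0 1"
     "f = restrict (twist s n (fst (par f)) (snd (par f))) unit_circle"
      unfolding par_def by blast+
  qed
  have F_one: "F (f, 1) = f" if "f \<in> X" for f
    using par(3)[OF that] by (simp add: F_def)
  have F_zero: "F (f, 0) \<in> SO2" if "f \<in> X" for f
    using par(1)[OF that] by (auto simp: F_def twist_zero SO2_def)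
  have F_SO2: "F (f, 0) = f" if "f \<in> SO2" for f
  proof -
    have fX: "f \<in> X" using that SO2_subset_twist_family by (auto simp: X_def)
    from that obtain \<tau> where \<tau>: "\<tau> \<in> unit_circle" and f: "f = restrict (twist s n \<tau> (\<lambda>k. 0)) unit_circle"
      by (auto simp: SO2_def twist_zero)
    \<comment> \<open>The parameters chosen for a rotation are not known to be zeros at the origin,
      so uniqueness is applied with \<open>c = 0\<close>; \<open>0 * 0\<close> has the shape
      \<open>c * b k\<close>.\<close>
    have "twist s n (fst (par f)) (\<lambda>k. 0 * snd (par f) k) = twist s n \<tau> (\<lambda>k. 0 * 0)"
    proof (rule twist_parameters_unique(2)[OF s par(1)[OF fX] \<tau>])
      show "\<forall>k\<in>{1..n}. snd (par f) k \<in> cball 0 1"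
        using par(2)[OF fX] by (auto simp: less_eq_real_def)
      show "twist s n (fst (par f)) (snd (par f)) \<zeta> = twist s n \<tau> (\<lambda>k. 0) \<zeta>"
        if "\<zeta> \<in> unit_circle - snd (par f) ` {1..n}" for \<zeta>
        using fun_cong[OF trans[OF par(3)[OF fX, symmetric] f], of \<zeta>] that by simp
    qed auto
    then show ?thesis
      using f by (simp add: F_def)
  qed
  have F_X: "F (f, t) \<in> X" if f: "f \<in> X" and t: "t \<in> {0..1}" for f t
  \<comment> \<open>Strict positivity of the speed is available only inside the disk, that is, for
    \<open>t < 1\<close>; on the circle it may vanish, so \<open>t = 1\<close> is treated by
    \<open>F (f, 1) = f\<close>.\<close>
  proof (cases "t = 1")
    case True
    then show ?thesis using F_one f by simp
  next
    case False
    let ?\<sigma> = "fst (par f)" and ?a = "snd (par f)"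
    have "inj_on f unit_circle"
      using f homeomorphic_imp_injective_map
      by (fastforce simp: X_def twist_family_def H_plus_def)
    then have inj: "inj_on (twist s n ?\<sigma> ?a) unit_circle"
      using par(3)[OF f] by (metis inj_on_restrict_eq)
    have scaled: "\<forall>k\<in>{1..n}. of_real t * ?a k \<in> ball 0 1"
    proof
      fix k assume k: "k \<in> {1..n}"
      have "\<bar>t\<bar> * norm (?a k) \<le> 1 * norm (?a k)"
        using t by (intro mult_right_mono) auto
      with par(2)[OF f] k show "of_real t * ?a k \<in> ball 0 1"
        by (force simp: norm_mult)
    qed
    have "F (f, t) \<in> H_plus"
      unfolding F_def prod.case
    proof (rule restrict_twist_in_H_plus[OF scaled par(1)[OF f]])
      fix \<zeta> assume "\<zeta> \<in> unit_circle"
      then show "0 < Re (twist_speed s n (\<lambda>k. of_real t * ?a k) \<zeta>)"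
        unfolding twist_speed_scale using t False
        by (intro Re_twist_speed_pos[OF par(2)[OF f]] Re_twist_speed_nonneg[OF par(2)[OF f] par(1)[OF f] inj])
           (auto simp: norm_mult)
    qed
    moreover have "\<exists>\<sigma> a. F (f, t) = restrict (twist s n \<sigma> a) unit_circle \<and>
        \<sigma> \<in> unit_circle \<and> (\<forall>k\<in>{1..n}. a k \<in> ball 0 1)"
      using scaled par(1)[OF f] unfolding F_def prod.case by blast
    ultimately show ?thesis
      unfolding X_def twist_family_def by blast
  qed
  have "continuous_map (prod_topology (subtopology CT X) (top_of_set {0..1})) (subtopology CT X) F"
  proof (rule continuous_map_into_CT[where F = F, OF X_top F_X])
    fix f t and \<epsilon> :: real assume f: "f \<in> X" and t: "t \<in> {0..1::real}" and \<epsilon>: "\<epsilon> > 0"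
    obtain \<delta> where \<delta>: "\<delta> > 0" and close: "\<And>\<sigma> a u. \<sigma> \<in> unit_circle \<Longrightarrow> (\<forall>k\<in>{1..n}. a k \<in> ball 0 1) \<Longrightarrow> u \<in> {0..1} \<Longrightarrow>
           \<bar>u - t\<bar> < \<delta> \<Longrightarrow>
           (\<forall>\<zeta>\<in>unit_circle. dist (twist s n \<sigma> a \<zeta>) (twist s n (fst (par f)) (snd (par f)) \<zeta>) < \<delta>) \<Longrightarrow>
           (\<forall>\<zeta>\<in>unit_circle. dist (twist s n \<sigma> (\<lambda>k. of_real u * a k) \<zeta>)
              (twist s n (fst (par f)) (\<lambda>k. of_real t * snd (par f) k) \<zeta>) < \<epsilon>)"
      using twist_scaling_continuous[OF s par(1)[OF f] par(2)[OF f] t \<epsilon>] by blast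
    have eval: "g \<zeta> = twist s n (fst (par g)) (snd (par g)) \<zeta>" if "g \<in> X" "\<zeta> \<in> unit_circle" for g \<zeta>
      using fun_cong[OF par(3)[OF that(1)], of \<zeta>] that(2) by simp
    show "\<exists>\<delta>>0. \<forall>g u. g \<in> X \<longrightarrow> u \<in> {0..1} \<longrightarrow> \<bar>u - t\<bar> < \<delta> \<longrightarrow>
        (\<forall>\<zeta>\<in>unit_circle. dist (g \<zeta>) (f \<zeta>) < \<delta>) \<longrightarrow>
        (\<forall>\<zeta>\<in>unit_circle. dist (F (g, u) \<zeta>) (F (f, t) \<zeta>) < \<epsilon>)"
    proof (intro exI conjI allI impI)
      fix g u assume g: "g \<in> X" and u: "u \<in> {0..1::real}" "\<bar>u - t\<bar> < \<delta>"
        and d: "\<forall>\<zeta>\<in>unit_circle. dist (g \<zeta>) (f \<zeta>) < \<delta>"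
      have "\<forall>\<zeta>\<in>unit_circle. dist (twist s n (fst (par g)) (snd (par g)) \<zeta>)
          (twist s n (fst (par f)) (snd (par f)) \<zeta>) < \<delta>"
        using d eval[OF g] eval[OF f] by (metis (no_types, lifting))
      from close[OF par(1)[OF g] par(2)[OF g] u this]
      show "\<forall>\<zeta>\<in>unit_circle. dist (F (g, u) \<zeta>) (F (f, t) \<zeta>) < \<epsilon>"
        by (simp add: F_def)
    qed (fact \<delta>)
  qed
  then show ?thesis
    unfolding deformation_retract_of_space_def X_def[symmetric]
    using X_top SO2_subset_twist_family[of s n] F_one F_zero F_SO2
    by (intro conjI exI[of _ F]) (auto simp: X_def)
qed

section \<open>Connectedness\<close>

text \<open>Two rotations differ at every point of the circle by the distance of their factors, so
  the connected circle maps continuously onto \<open>SO2\<close>, with \<delta> equal to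
  \<epsilon>.\<close>

lemma connectedin_SO2: "connectedin CT SO2"
proof -
  define m where "m = cfunspace (top_of_set unit_circle) (euclidean_metric :: complex metric)"
  define mT where "mT = submetric (euclidean_metric :: complex metric) unit_circle"
  define R where "R \<sigma> = restrict (\<lambda>z. \<sigma> * z) unit_circle" for \<sigma> :: complex
  interpret M: Metric_space "mspace m" "mdist m" by simp
  interpret T: Metric_space "mspace mT" "mdist mT" by simp
  have CT: "CT = M.mtopology"
    by (simp add: CT_def m_def mtopology_of_def)
  have T: "top_of_set unit_circle = T.mtopology"
    using mtopology_of_submetric[of euclidean_metric "unit_circle"]
    by (simp add: mT_def mtopology_of_def)
  have mspace_mT: "mspace mT = unit_circle"
    by (auto simp: mT_def)
  have R_SO2: "R ` unit_circle = SO2"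
    by (auto simp: R_def SO2_def)
  have "SO2 \<subseteq> topspace CT"
    using SO2_subset_twist_family[of 1 1] by (auto simp: twist_family_def H_plus_def)
  then have sub: "R ` unit_circle \<subseteq> mspace m"
    unfolding R_SO2 CT by simp
  have "continuous_map (top_of_set unit_circle) CT R"
    unfolding CT T T.metric_continuous_map[OF M.Metric_space_axioms, unfolded mspace_mT] mspace_mT
  proof (intro conjI ballI allI impI)
    show "R ` unit_circle \<subseteq> mspace m" by (fact sub)
    fix \<sigma> and \<epsilon> :: real assume \<epsilon>: "\<epsilon> > 0"
    show "\<exists>\<delta>>0. \<forall>\<tau>. \<tau> \<in> unit_circle \<and> mdist mT \<sigma> \<tau> < \<delta> \<longrightarrow> mdist m (R \<sigma>) (R \<tau>) < \<epsilon>"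
    proof (intro exI conjI allI impI)
      fix \<tau> assume \<tau>: "\<tau> \<in> unit_circle \<and> mdist mT \<sigma> \<tau> < \<epsilon>"
      have "dist (\<sigma> * z) (\<tau> * z) = dist \<sigma> \<tau>" if "z \<in> unit_circle" for z
        using that by (simp add: dist_norm norm_mult flip: left_diff_distrib)
      then have "mdist m (R \<sigma>) (R \<tau>) \<le> dist \<sigma> \<tau>"
        unfolding m_def by (intro mdist_cfunspace_le) (auto simp: R_def)
      with \<tau> show "mdist m (R \<sigma>) (R \<tau>) < \<epsilon>"
        by (simp add: mT_def)
    qed (fact \<epsilon>)
  qed
  then have "connectedin CT (R ` unit_circle)"
    by (rule connectedin_continuous_map_image) (simp add: connectedin_subtopology connected_sphere)
  then show ?thesis
    by (simp add: R_SO2)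
qed

text \<open>Each point is joined to the connected set \<open>A\<close> by its own trajectory, so two
  trajectories together with \<open>A\<close> form a connected set through any two given
  points.\<close>

lemma deformation_retract_connected_space:
  assumes "A deformation_retract_of_space X" and A: "connectedin X A"
  shows "connected_space X"
proof -
  obtain F where F: "continuous_map (prod_topology X (top_of_set {0..1::real})) X F"
    and F1: "\<And>x. x \<in> topspace X \<Longrightarrow> F (x, 1) = x" and F0: "\<And>x. x \<in> topspace X \<Longrightarrow> F (x, 0) \<in> A"
    using assms(1) unfolding deformation_retract_of_space_def by blast
  define path where "path x = (\<lambda>t. F (x, t)) ` {0..1}" for x
  have path: "connectedin X (path x)" if x: "x \<in> topspace X" for x
  proof -
    have "continuous_map (top_of_set {0..1}) X (\<lambda>t. F (x, t))"
      using continuous_map_compose[OF _ F, of _ "\<lambda>t. (x, t)"] x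
      by (simp add: o_def continuous_map_pairwise)
    then show ?thesis
      unfolding path_def
      by (rule connectedin_continuous_map_image) (simp add: connectedin_subtopology)
  qed
  have ends: "x \<in> path x" "F (x, 0) \<in> path x" if "x \<in> topspace X" for x
    using F1[OF that] by (auto simp: path_def image_iff intro: bexI[of _ 1])
  have "connected_component_of X x y" if x: "x \<in> topspace X" and y: "y \<in> topspace X" for x y
  proof -
    have "connectedin X (path x \<union> A)" "connectedin X (path y \<union> A)"
      using path[OF x] path[OF y] A ends(2)[OF x] ends(2)[OF y] F0[OF x] F0[OF y]
      by (auto intro!: connectedin_Un simp del: Un_subset_iff)
    then have "connectedin X ((path x \<union> A) \<union> (path y \<union> A))"
      using connectedin_Un[of X "path x \<union> A" "path y \<union> A"] F0[OF x] by blast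
    then show ?thesis
      using ends x y unfolding connected_component_of_def by blast
  qed
  then show ?thesis
    unfolding connected_space_iff_connected_component by blast
qed

lemma connectedin_twist_family:
  assumes "s = 1 \<or> s = -1"
  shows "connectedin CT (twist_family s n)"
proof -
  have "twist_family s n \<subseteq> topspace CT"
    by (auto simp: twist_family_def H_plus_def)
  moreover have "connected_space (subtopology CT (twist_family s n))"
    using connectedin_SO2 SO2_subset_twist_family[of s n]
    by (intro deformation_retract_connected_space[OF SO2_deformation_retract_of_twist_family[OF assms]])
       (auto simp: connectedin_subtopology)
  ultimately show ?thesis
    by (simp add: connectedin_def)
qed

lemma connectedin_Union_twist_family:
  assumes "s = 1 \<or> s = -1"
  shows "connectedin CT (\<Union>n\<in>{1..}. twist_family s n)"
proof (rule connectedin_Union)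
  show "\<Inter> (twist_family s ` {1..}) \<noteq> {}"
  proof -
    \<comment> \<open>The identity is a rotation and hence a common point of all the
      families.\<close>
    have "restrict (\<lambda>z. 1 * z) unit_circle \<in> SO2" unfolding SO2_def by force
    then show ?thesis using SO2_subset_twist_family by blast
  qed
qed (use connectedin_twist_family[OF assms] in auto)

theorem theorem4p1:
  shows "(\<forall>n\<ge>1. SO2 deformation_retract_of_space (subtopology CT (H_n1 n)) \<and>
                  SO2 deformation_retract_of_space (subtopology CT (H_n2 n)) \<and>
                  connectedin CT (H_n1 n) \<and> connectedin CT (H_n2 n)) \<and>
         connectedin CT (\<Union>n\<in>{1..}. H_n1 n) \<and>
         connectedin CT (\<Union>n\<in>{1..}. H_n2 n)"
proof -
  have "(\<Union>n\<in>{1..}. H_n1 n) = (\<Union>n\<in>{1..}. twist_family 1 n)"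
    and "(\<Union>n\<in>{1..}. H_n2 n) = (\<Union>n\<in>{1..}. twist_family (-1) n)"
    using H_n1_eq_twist_family H_n2_eq_twist_family by auto
  then show ?thesis
    using SO2_deformation_retract_of_twist_family connectedin_twist_family
      connectedin_Union_twist_family
    by (simp add: H_n1_eq_twist_family H_n2_eq_twist_family)
qed

end
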